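(* Let $N\ge 2$ and let $U_1,\dots,U_N,V_1,\dots,V_{N-1}:\mathbb{R}\to\mathbb{R}$ be smooth ($C^\infty$) functions. Suppose that there is $R\ge 0$ such that $V_k''(x)>0$ for $|x|\ge R$ and all $1\le k\le N-1$; that $U_k'(x)\to\pm\infty$ as $x\to\pm\infty$ for all $1\le k\le N$; and that for all $1\le k\le N-1$ and every $x\in\mathbb{R}$, $V_k''(x)\neq 0$ or $V_k'''(x)\ne 0$. Let $H$ be the Hamiltonian of the chain of oscillators and $L_F$ the Lie derivative along the vector field $F$ of the damped chain, as defined in the context. Then there is a bounded set $K\subset\mathbb{R}^{2N}$ such that for any $(p,q)\in\mathbb{R}^{2N}\setminus K$ there exists $1\le j\le 3\cdot 2^{N+1}-5$ for which $L_F^jH(p,q)\neq 0$.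
   Context: The chain of oscillators has phase space $\mathbb{R}^{2N}\ni(p,q)$ and Hamiltonian $$H(p,q)=\sum_{j=1}^N\frac{p_j^2}{2}+\sum_{j=1}^NU_j(q_j)+\sum_{j=1}^{N-1}V_j(q_j-q_{j+1}).$$ The equations of motion, with friction on the first oscillator, are $$\dot q_j=p_j,\qquad \dot p_j=-\delta_{j1}p_1-U_j'(q_j)+V_{j-1}'(q_{j-1}-q_j)-V_j'(q_j-q_{j+1}),\qquad 1\le j\le N,$$ where $V_0=V_N:=0$ and $\delta_{j1}$ is the Kronecker symbol. $F$ denotes the vector field on the right-hand side, $L_Ff=\operatorname{grad}(f)\cdot F$, and $L_F^j$ is the $j$-th iterate of $L_F$. *)

theory Defs
  imports "HOL-Analysis.Analysis"
begin

definition smooth :: "(real \<Rightarrow> real) \<Rightarrow> bool" where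
  "smooth f \<longleftrightarrow> (\<forall>k. (deriv ^^ k) f differentiable_on UNIV)"

text \<open>The phase space is \<open>real^'n \<times> real^'n\<close>, with points \<open>(p, q)\<close>. The chain has its
  oscillators ordered, so the coordinates are numbered by a bijection \<open>e\<close> from \<open>{1..N}\<close> onto the
  index type: \<open>p\<^sub>j\<close> is \<open>p $ e j\<close>, and \<open>CARD('n) = N\<close>. The values of \<open>e\<close> outside \<open>{1..N}\<close>, of \<open>U\<close>
  outside \<open>{1..N}\<close> and of \<open>V\<close> outside \<open>{1..<N}\<close> play no role.\<close>

type_synonym 'n phase = "(real^'n) \<times> (real^'n)"

definition hamiltonian ::
  "nat \<Rightarrow> (nat \<Rightarrow> 'n) \<Rightarrow> (nat \<Rightarrow> real \<Rightarrow> real) \<Rightarrow> (nat \<Rightarrow> real \<Rightarrow> real) \<Rightarrow> 'n::finite phase \<Rightarrow> real"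
where
  "hamiltonian N e U V = (\<lambda>(p, q).
      (\<Sum>j=1..N. (p $ e j)\<^sup>2 / 2) + (\<Sum>j=1..N. U j (q $ e j))
      + (\<Sum>j=1..N-1. V j (q $ e j - q $ e (j + 1))))"

text \<open>The convention \<open>V\<^sub>0 = V\<^sub>N := 0\<close>. In the force on oscillator \<open>j\<close> the coordinates \<open>e 0\<close> and
  \<open>e (N + 1)\<close> occur only as arguments of these zero functions.\<close>

definition bdry_zero :: "nat \<Rightarrow> (nat \<Rightarrow> real \<Rightarrow> real) \<Rightarrow> nat \<Rightarrow> real \<Rightarrow> real" where
  "bdry_zero N V j = (if 1 \<le> j \<and> j < N then V j else (\<lambda>_. 0))"

definition force ::
  "nat \<Rightarrow> (nat \<Rightarrow> 'n) \<Rightarrow> (nat \<Rightarrow> real \<Rightarrow> real) \<Rightarrow> (nat \<Rightarrow> real \<Rightarrow> real) \<Rightarrow> 'n::finite phase \<Rightarrow> nat \<Rightarrow> real"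
where
  "force N e U V = (\<lambda>(p, q) j.
      - (if j = 1 then p $ e 1 else 0) - deriv (U j) (q $ e j)
      + deriv (bdry_zero N V (j - 1)) (q $ e (j - 1) - q $ e j)
      - deriv (bdry_zero N V j) (q $ e j - q $ e (j + 1)))"

definition chain_field ::
  "nat \<Rightarrow> (nat \<Rightarrow> 'n) \<Rightarrow> (nat \<Rightarrow> real \<Rightarrow> real) \<Rightarrow> (nat \<Rightarrow> real \<Rightarrow> real) \<Rightarrow> 'n::finite phase \<Rightarrow> 'n phase"
where
  "chain_field N e U V = (\<lambda>(p, q).
      ((\<Sum>j=1..N. force N e U V (p, q) j *\<^sub>R axis (e j) 1), p))"

lemma chain_field_component:
  assumes "bij_betw e {1..N} (UNIV :: 'n::finite set)" "j \<in> {1..N}"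
  shows "fst (chain_field N e U V (p, q)) $ e j = force N e U V (p, q) j"
proof -
  have "(axis (e i) 1 :: real^'n) $ e j = (if i = j then 1 else 0)" if "i \<in> {1..N}" for i
  proof -
    have "e j = e i \<longleftrightarrow> i = j"
      using assms that by (metis bij_betw_imp_inj_on inj_on_eq_iff)
    then show ?thesis
      unfolding axis_def by simp
  qed
  then have "(\<Sum>i=1..N. force N e U V (p, q) i * (axis (e i) 1 :: real^'n) $ e j)
      = (\<Sum>i=1..N. if i = j then force N e U V (p, q) i else 0)"
    by (intro sum.cong refl) simp
  then show ?thesis
    using assms(2) unfolding chain_field_def
    by (simp del: One_nat_def)
qed

definition grad :: "('a::real_inner \<Rightarrow> real) \<Rightarrow> 'a \<Rightarrow> 'a" where
  "grad f x = (THE D. GDERIV f x :> D)"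

lemma grad_eqI:
  assumes "GDERIV f x :> D"
  shows "grad f x = D"
  unfolding grad_def
proof (rule the_equality)
  show "GDERIV f x :> D" by (rule assms)
next
  fix D' assume "GDERIV f x :> D'"
  then have "(\<lambda>h. inner h D') = (\<lambda>h. inner h D)"
    using assms unfolding gderiv_def by (rule has_derivative_unique)
  then have "inner (D' - D) D' = inner (D' - D) D"
    by (rule fun_cong)
  then have "inner (D' - D) (D' - D) = 0"
    by (simp add: inner_diff_right)
  then show "D' = D" by simp
qed

definition lie :: "('a::real_inner \<Rightarrow> 'a) \<Rightarrow> ('a \<Rightarrow> real) \<Rightarrow> 'a \<Rightarrow> real" where
  "lie F f = (\<lambda>x. grad f x \<bullet> F x)"

end

theory Submission
  imports Defs
begin

text \<open>Along the flow of \<open>F\<close> the energy satisfies \<open>L\<^sub>F H = - p\<^sub>1\<^sup>2\<close>, so if many derivatives of \<open>H\<close> vanish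
  at a point, then the formal Taylor series of \<open>p\<^sub>1\<close> along the flow vanishes to high order. The
  equation of motion of \<open>p\<^sub>k\<close> then says that \<open>V\<^sub>k'(q\<^sub>k - q\<^sub>k\<^sub>+\<^sub>1)\<close> is constant to high order; as
  \<open>V\<^sub>k''\<close> and \<open>V\<^sub>k'''\<close> have no common zero, \<open>q\<^sub>k - q\<^sub>k\<^sub>+\<^sub>1\<close> is constant to about half that order, and
  therefore \<open>p\<^sub>k\<^sub>+\<^sub>1\<close> vanishes to about half the order. The order of vanishing of \<open>p\<^sub>k\<close>
  is \<open>3 * 2 ^ (N + 1 - k) - 2\<close>, hence at least 4 for all of them, and the point is an equilibrium.
  Equilibria form a bounded set, because the couplings are repulsive with bounded force only, while
  the pinning forces are unbounded.\<close>

subsection \<open>Orders of vanishing of formal power series\<close>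

text \<open>Orders of vanishing are expressed by divisibility because
  \<open>subdegree 0 = 0\<close>: the zero series then vanishes to every order, and sums and
  multiples follow from the \<open>dvd\<close> rules.\<close>

lemma fps_X_power_dvd_iff:
  fixes a :: "real fps"
  shows "fps_X ^ n dvd a \<longleftrightarrow> a = 0 \<or> n \<le> subdegree a"
proof (cases "a = 0")
  case False
  then show ?thesis
    using fps_dvd_iff[of "fps_X ^ n" a] by simp
qed simp

lemma fps_X_power_dvd_iff_nth:
  fixes a :: "real fps"
  shows "fps_X ^ n dvd a \<longleftrightarrow> (\<forall>i<n. fps_nth a i = 0)"
proof
  assume "\<forall>i<n. fps_nth a i = 0"
  then show "fps_X ^ n dvd a"
    using subdegree_geI[of a n] by (auto simp: fps_X_power_dvd_iff)
qed (auto simp: fps_X_power_dvd_iff intro: nth_less_subdegree_zero)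

lemma fps_X_power_dvd_deriv:
  fixes a :: "real fps"
  assumes "fps_X ^ Suc n dvd a"
  shows "fps_X ^ n dvd fps_deriv a"
  using assms by (simp add: fps_X_power_dvd_iff_nth del: power_Suc)

text \<open>A nonzero square has even order, so order at least \<open>2 * n - 1\<close> is already
  order at least \<open>2 * n\<close>.\<close>

lemma fps_X_power_dvd_square:
  fixes a :: "real fps"
  assumes "fps_X ^ (2 * n - 1) dvd a * a"
  shows "fps_X ^ n dvd a"
  using assms by (cases "a = 0") (simp_all add: fps_X_power_dvd_iff)

text \<open>\<open>s\<close> is a unit of the power series ring, so cancelling it costs no
  order.\<close>

lemma fps_X_power_dvd_unit_mult:
  fixes s r :: "real fps"
  assumes "fps_X ^ n dvd s * r" "fps_nth s 0 \<noteq> 0"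
  shows "fps_X ^ n dvd r"
proof -
  have "s \<noteq> 0" using assms(2) by auto
  with assms show ?thesis
    by (cases "r = 0") (simp_all add: fps_X_power_dvd_iff)
qed

text \<open>If \<open>r\<close> vanishes to order \<open>d\<close>, then so does \<open>s'\<close>, hence \<open>s\<close> vanishes to order \<open>d + 1\<close> and
  \<open>s * r\<close> to order \<open>2 * d + 1\<close>.\<close>

lemma fps_X_power_dvd_degenerate:
  fixes s r c :: "real fps"
  assumes dvd: "fps_X ^ (2 * k) dvd s * r"
    and s0: "fps_nth s 0 = 0" and s': "fps_deriv s = c * r" and c0: "fps_nth c 0 \<noteq> 0"
  shows "fps_X ^ k dvd r"
proof (cases "r = 0")
  case False
  define d where "d = subdegree r"
  have "fps_nth s (Suc d) \<noteq> 0"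
  proof -
    have "fps_nth (fps_deriv s) d = fps_nth c 0 * fps_nth r d"
      unfolding s' d_def by simp
    moreover have "fps_nth r d \<noteq> 0" using False unfolding d_def by simp
    ultimately show ?thesis using c0 by auto
  qed
  then have "s \<noteq> 0" "subdegree s \<le> Suc d"
    by (auto intro: subdegree_leI)
  \<comment> \<open>\<open>2 * k\<close> is at most \<open>Suc d + d\<close>, hence
    \<open>k \<le> d\<close> by parity.\<close>
  with dvd False show ?thesis
    by (simp add: fps_X_power_dvd_iff d_def)
qed simp

subsection \<open>Smooth functions\<close>

lemma smooth_deriv: "smooth g \<Longrightarrow> smooth (deriv g)"
  unfolding smooth_def by (metis funpow_Suc_right comp_apply)

lemma smooth_DERIV:
  assumes "smooth g"
  shows "(g has_real_derivative deriv g x) (at x)"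
proof -
  have "g differentiable_on UNIV"
    using assms unfolding smooth_def by (metis funpow_0)
  then show ?thesis
    by (simp add: differentiable_on_def DERIV_deriv_iff_real_differentiable)
qed

lemma smooth_const: "smooth (\<lambda>_. c)"
proof -
  have "(deriv ^^ k) (\<lambda>_. c) = (\<lambda>_. if k = 0 then c else 0)" for k
    by (induction k) auto
  then show ?thesis
    unfolding smooth_def by simp
qed

subsection \<open>The Lie derivative as a derivation\<close>

text \<open>The gradient is the Riesz representative \<open>adjoint f' 1\<close> of the
  derivative.\<close>

lemma lie_eqI:
  fixes f :: "'a::euclidean_space \<Rightarrow> real"
  assumes "(f has_derivative f') (at x)"
  shows "lie F f x = f' (F x)"
proof -
  have "linear f'"
    using assms has_derivative_linear by blast
  then have f': "f' h = h \<bullet> adjoint f' 1" for h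
    using adjoint_works[of f' h 1] by simp
  then have "GDERIV f x :> adjoint f' 1"
    using assms unfolding gderiv_def by (metis (no_types, lifting) ext)
  then show ?thesis
    unfolding lie_def by (simp add: grad_eqI f' inner_commute)
qed

text \<open>A class of functions closed under the Lie derivative along any vector field with
  components in the class, so that no general theory of higher derivatives is needed.\<close>

inductive observable :: "('a::euclidean_space \<Rightarrow> real) \<Rightarrow> bool" where
  observable_const: "observable (\<lambda>_. c)"
| observable_coord: "observable (\<lambda>x. x \<bullet> b)"
| observable_add: "observable f \<Longrightarrow> observable g \<Longrightarrow> observable (\<lambda>x. f x + g x)"
| observable_mult: "observable f \<Longrightarrow> observable g \<Longrightarrow> observable (\<lambda>x. f x * g x)"
| observable_comp: "smooth h \<Longrightarrow> observable f \<Longrightarrow> observable (\<lambda>x. h (f x))"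

lemma observable_uminus: "observable f \<Longrightarrow> observable (\<lambda>x. - f x)"
  using observable_mult[OF observable_const[of "-1"]] by simp

lemma observable_diff: "observable f \<Longrightarrow> observable g \<Longrightarrow> observable (\<lambda>x. f x - g x)"
  using observable_add[OF _ observable_uminus] by simp

lemma observable_sum: "(\<And>i. i \<in> I \<Longrightarrow> observable (f i)) \<Longrightarrow> observable (\<lambda>x. \<Sum>i\<in>I. f i x)"
  by (induction I rule: infinite_finite_induct) (auto intro: observable_const observable_add)

lemma smooth_comp_has_derivative:
  assumes "smooth h" "(f has_derivative f') (at x)"
  shows "((\<lambda>x. h (f x)) has_derivative (\<lambda>v. deriv h (f x) * f' v)) (at x)"
  using has_derivative_compose[OF assms(2) smooth_DERIV[OF assms(1), unfolded has_field_derivative_def]]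
  by simp

lemma observable_has_derivative:
  assumes "observable f"
  obtains f' where "(f has_derivative f') (at x)"
proof -
  have "f differentiable at x"
    using assms
  proof induction
    case (observable_comp h f)
    then show ?case
      using smooth_comp_has_derivative unfolding differentiable_def by blast
  next
    case (observable_coord b)
    show ?case
      by (rule differentiableI) (auto intro!: derivative_eq_intros)
  qed auto
  then show ?thesis
    using that unfolding differentiable_def by blast
qed

section \<open>Calculus rules for the Lie derivative\<close>

lemma lie_const: "lie F (\<lambda>_. c) = (\<lambda>_::'a::euclidean_space. 0)"
  by (rule ext, subst lie_eqI[where f' = "\<lambda>_. 0"]) auto

lemma lie_coord: "lie F (\<lambda>x. x \<bullet> b) = (\<lambda>x::'a::euclidean_space. F x \<bullet> b)"
  by (rule ext, subst lie_eqI[where f' = "\<lambda>h. h \<bullet> b"]) (auto intro!: derivative_eq_intros)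

lemma lie_add:
  assumes "observable f" "observable g"
  shows "lie F (\<lambda>x. f x + g x) = (\<lambda>x. lie F f x + lie F g x)"
proof
  fix x
  obtain f' g' where "(f has_derivative f') (at x)" "(g has_derivative g') (at x)"
    using assms observable_has_derivative by metis
  then show "lie F (\<lambda>x. f x + g x) x = lie F f x + lie F g x"
    by (simp add: lie_eqI[OF has_derivative_add] lie_eqI)
qed

lemma lie_mult:
  assumes "observable f" "observable g"
  shows "lie F (\<lambda>x. f x * g x) = (\<lambda>x. lie F f x * g x + f x * lie F g x)"
proof
  fix x
  obtain f' g' where "(f has_derivative f') (at x)" "(g has_derivative g') (at x)"
    using assms observable_has_derivative by metis
  then show "lie F (\<lambda>x. f x * g x) x = lie F f x * g x + f x * lie F g x"
    by (simp add: lie_eqI[OF has_derivative_mult] lie_eqI)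
qed

lemma lie_comp:
  assumes "smooth h" "observable f"
  shows "lie F (\<lambda>x. h (f x)) = (\<lambda>x. deriv h (f x) * lie F f x)"
proof
  fix x
  obtain f' where "(f has_derivative f') (at x)"
    using assms observable_has_derivative by metis
  then show "lie F (\<lambda>x. h (f x)) x = deriv h (f x) * lie F f x"
    by (simp add: lie_eqI[OF smooth_comp_has_derivative[OF assms(1)]] lie_eqI)
qed

lemma lie_uminus: "observable f \<Longrightarrow> lie F (\<lambda>x. - f x) = (\<lambda>x. - lie F f x)"
  using lie_mult[OF observable_const[of "-1"], of f F] by (simp add: lie_const)

lemma lie_diff:
  "observable f \<Longrightarrow> observable g \<Longrightarrow> lie F (\<lambda>x. f x - g x) = (\<lambda>x. lie F f x - lie F g x)"
  using lie_add[of f "\<lambda>x. - g x" F] by (simp add: lie_uminus observable_uminus)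

lemma lie_sum:
  assumes "\<And>i. i \<in> I \<Longrightarrow> observable (f i)"
  shows "lie F (\<lambda>x. \<Sum>i\<in>I. f i x) = (\<lambda>x. \<Sum>i\<in>I. lie F (f i) x)"
  using assms
proof (induction I rule: infinite_finite_induct)
  case (insert i I)
  then show ?case
    using lie_add[of "f i" "\<lambda>x. \<Sum>i\<in>I. f i x" F] by (simp add: observable_sum)
qed (simp_all add: lie_const)

text \<open>Induction on the construction of \<open>f\<close>: coordinates give components of
  \<open>F\<close>, products the Leibniz rule, and composition with \<open>h\<close> brings in
  \<open>deriv h\<close>, which is again smooth.\<close>

lemma observable_lie:
  assumes "\<And>b. observable (\<lambda>x. F x \<bullet> b)" "observable f"
  shows "observable (lie F f)"
  using assms(2)
proof induction
  case (observable_add f g)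
  then show ?case by (simp add: lie_add observable.observable_add)
next
  case (observable_mult f g)
  then show ?case
    by (auto simp: lie_mult intro!: observable.observable_add observable.observable_mult)
next
  case (observable_comp h f)
  then have "observable (\<lambda>x. deriv h (f x) * lie F f x)"
    by (intro observable.observable_mult observable.observable_comp[OF smooth_deriv])
  with observable_comp.hyps show ?case
    by (simp add: lie_comp)
qed (simp_all add: lie_const lie_coord observable_const assms(1))

subsection \<open>The formal Taylor series along the flow\<close>

text \<open>The Taylor series at time 0 of \<open>f\<close> along the solution of
  \<open>x' = F x\<close> starting at \<open>x\<close>, written without solving the equation. The
  factorials turn \<open>lie F\<close> into \<open>fps_deriv\<close> and products of functions into
  Cauchy products.\<close>

definition flow_series :: "('a::euclidean_space \<Rightarrow> 'a) \<Rightarrow> 'a \<Rightarrow> ('a \<Rightarrow> real) \<Rightarrow> real fps" where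
  "flow_series F x f = Abs_fps (\<lambda>i. (lie F ^^ i) f x / fact i)"

lemma flow_series_nth: "fps_nth (flow_series F x f) i = (lie F ^^ i) f x / fact i"
  by (simp add: flow_series_def)

lemma flow_series_nth_0 [simp]: "fps_nth (flow_series F x f) 0 = f x"
  by (simp add: flow_series_nth)

lemma fps_deriv_flow_series: "fps_deriv (flow_series F x f) = flow_series F x (lie F f)"
  by (rule fps_ext) (simp add: flow_series_nth funpow_Suc_right field_simps del: funpow.simps of_nat_Suc)

text \<open>Lets inductions on the coefficient index pass from a function to its Lie
  derivative.\<close>

lemma fps_nth_Suc_deriv: "fps_nth (a :: real fps) (Suc n) = fps_nth (fps_deriv a) n / real (Suc n)"
  by simp

lemma flow_series_const: "flow_series F x (\<lambda>_. c) = fps_const c"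
proof (rule fps_ext)
  fix n
  have "(lie F ^^ i) (\<lambda>_. 0) = (\<lambda>_. 0)" for i
    by (induction i) (auto simp: lie_const)
  then show "fps_nth (flow_series F x (\<lambda>_. c)) n = fps_nth (fps_const c) n"
    by (cases n) (simp_all add: flow_series_nth funpow_Suc_right lie_const del: funpow.simps)
qed

section \<open>Taylor expansion as a ring homomorphism on observables\<close>

context
  fixes F :: "'a::euclidean_space \<Rightarrow> 'a"
  assumes F: "\<And>b. observable (\<lambda>x. F x \<bullet> b)"
begin

lemma observable_lie_field: "observable f \<Longrightarrow> observable (lie F f)"
  by (rule observable_lie) (rule F)

lemma flow_series_add:
  assumes "observable f" "observable g"
  shows "flow_series F x (\<lambda>x. f x + g x) = flow_series F x f + flow_series F x g"
proof (rule fps_ext)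
  fix n
  show "fps_nth (flow_series F x (\<lambda>x. f x + g x)) n = fps_nth (flow_series F x f + flow_series F x g) n"
    using assms
  proof (induction n arbitrary: f g)
    case (Suc n)
    then show ?case
      by (simp only: fps_nth_Suc_deriv fps_deriv_add fps_deriv_flow_series lie_add observable_lie_field)
  qed simp
qed

text \<open>The constant terms agree, and so do the formal derivatives by the Leibniz rule. The
  induction varies \<open>f\<close> and \<open>g\<close>, as differentiating replaces one of them by
  its Lie derivative.\<close>

lemma flow_series_mult:
  assumes "observable f" "observable g"
  shows "flow_series F x (\<lambda>x. f x * g x) = flow_series F x f * flow_series F x g"
proof (rule fps_ext)
  fix n
  show "fps_nth (flow_series F x (\<lambda>x. f x * g x)) n = fps_nth (flow_series F x f * flow_series F x g) n"
    using assms
  proof (induction n arbitrary: f g)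
    case (Suc n)
    have "fps_nth (flow_series F x (lie F (\<lambda>x. f x * g x))) n =
        fps_nth (flow_series F x (\<lambda>x. lie F f x * g x)) n + fps_nth (flow_series F x (\<lambda>x. f x * lie F g x)) n"
      using Suc.prems by (simp only: lie_mult flow_series_add observable_mult observable_lie_field fps_add_nth)
    also have "\<dots> = fps_nth (fps_deriv (flow_series F x f * flow_series F x g)) n"
      using Suc by (simp only: observable_lie_field fps_deriv_flow_series fps_deriv_mult fps_add_nth add.commute)
    finally show ?case
      by (simp only: fps_nth_Suc_deriv fps_deriv_flow_series)
  qed simp
qed

lemma flow_series_uminus: "observable f \<Longrightarrow> flow_series F x (\<lambda>x. - f x) = - flow_series F x f"
  using flow_series_mult[OF observable_const[of "-1"], of f x]
  by (simp add: flow_series_const fps_const_neg[symmetric] del: fps_const_neg)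

lemma flow_series_diff:
  "observable f \<Longrightarrow> observable g \<Longrightarrow>
    flow_series F x (\<lambda>x. f x - g x) = flow_series F x f - flow_series F x g"
  using flow_series_add[of f "\<lambda>x. - g x" x] by (simp add: flow_series_uminus observable_uminus)

lemma fps_deriv_flow_series_comp:
  assumes "smooth h" "observable f"
  shows "fps_deriv (flow_series F x (\<lambda>x. h (f x))) =
    flow_series F x (\<lambda>x. deriv h (f x)) * flow_series F x (lie F f)"
  using assms observable_comp[OF smooth_deriv[OF assms(1)] assms(2)]
  by (simp add: fps_deriv_flow_series lie_comp flow_series_mult observable_lie_field)

text \<open>Let \<open>s\<close> be the series of \<open>deriv h\<close> along \<open>f\<close> and
  \<open>r\<close> that of \<open>lie F f\<close>; then \<open>s * r\<close> vanishes to order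
  \<open>2 * k\<close>. Either \<open>s\<close> is a unit and can be cancelled, or it vanishes at 0
  and its derivative is a unit times \<open>r\<close>, the situation of
  \<open>fps_X_power_dvd_degenerate\<close>.\<close>

lemma fps_X_power_dvd_flow_series_comp:
  assumes "smooth h" "observable f" "deriv h (f x) \<noteq> 0 \<or> deriv (deriv h) (f x) \<noteq> 0"
    and dvd: "fps_X ^ (2 * k) dvd fps_deriv (flow_series F x (\<lambda>x. h (f x)))"
  shows "fps_X ^ k dvd flow_series F x (lie F f)"
proof (cases "deriv h (f x) = 0")
  case True
  note dvd = dvd[unfolded fps_deriv_flow_series_comp[OF assms(1,2)]]
  show ?thesis
    by (rule fps_X_power_dvd_degenerate[OF dvd _ fps_deriv_flow_series_comp])
      (use True assms in \<open>auto intro: smooth_deriv\<close>)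
next
  case False
  note dvd = dvd[unfolded fps_deriv_flow_series_comp[OF assms(1,2)]]
  have "fps_X ^ (2 * k) dvd flow_series F x (lie F f)"
    by (rule fps_X_power_dvd_unit_mult[OF dvd]) (use False in simp)
  then show ?thesis
    by (rule power_le_dvd) simp
qed

end

subsection \<open>The chain of oscillators\<close>

abbreviation mom :: "(nat \<Rightarrow> 'n::finite) \<Rightarrow> nat \<Rightarrow> 'n phase \<Rightarrow> real" where
  "mom e j x \<equiv> fst x $ e j"

abbreviation pos :: "(nat \<Rightarrow> 'n::finite) \<Rightarrow> nat \<Rightarrow> 'n phase \<Rightarrow> real" where
  "pos e j x \<equiv> snd x $ e j"

lemma mom_eq_inner: "mom e j x = x \<bullet> (axis (e j) 1, 0)"
  by (cases x) (simp add: inner_axis)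

lemma pos_eq_inner: "pos e j x = x \<bullet> (0, axis (e j) 1)"
  by (cases x) (simp add: inner_axis)

lemma observable_mom: "observable (mom e j)"
  unfolding mom_eq_inner by (rule observable_coord)

lemma observable_pos: "observable (pos e j)"
  unfolding pos_eq_inner by (rule observable_coord)

lemma observable_bond: "observable (\<lambda>x. pos e i x - pos e j x)"
  by (intro observable_diff observable_pos)

lemma force_eq:
  "force N e U V x j =
    - (if j = 1 then mom e 1 x else 0) - deriv (U j) (pos e j x)
    + deriv (bdry_zero N V (j - 1)) (pos e (j - 1) x - pos e j x)
    - deriv (bdry_zero N V j) (pos e j x - pos e (j + 1) x)"
  by (cases x) (simp add: force_def)

text \<open>Summation by parts. With momenta \<open>P\<close> and bond forces \<open>a\<close>, the
  work of the bonds on the oscillators cancels the change of bond energy, up to end terms that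
  vanish when \<open>a 0\<close> and \<open>a n\<close> do.\<close>

lemma sum_bond_power:
  fixes P a :: "nat \<Rightarrow> real"
  assumes "1 \<le> n"
  shows "(\<Sum>j=1..n. P j * (a (j - 1) - a j)) + (\<Sum>j=1..n-1. a j * (P j - P (j + 1)))
    = P 1 * a 0 - P n * a n"
  using assms
proof (induction n rule: nat_induct_at_least)
  case (Suc n)
  then obtain m where "n = Suc m" by (cases n) auto
  with Suc.IH show ?case by (simp add: algebra_simps)
qed (simp add: algebra_simps)

locale oscillator_chain =
  fixes N :: nat and e :: "nat \<Rightarrow> 'n::finite" and U V :: "nat \<Rightarrow> real \<Rightarrow> real"
  assumes N: "N \<ge> 1"
    and bij: "bij_betw e {1..N} (UNIV :: 'n set)"
    and smooth_U: "\<And>k. k \<in> {1..N} \<Longrightarrow> smooth (U k)"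
    and smooth_V: "\<And>k. k \<in> {1..N-1} \<Longrightarrow> smooth (V k)"
begin

abbreviation "W \<equiv> bdry_zero N V"
abbreviation "F \<equiv> chain_field N e U V"

lemma smooth_W: "smooth (W k)"
  using smooth_V[of k] by (auto simp: bdry_zero_def smooth_const)

lemma deriv_W_0 [simp]: "deriv (W 0) = (\<lambda>_. 0)"
  by (auto simp: bdry_zero_def)

lemma deriv_W_N [simp]: "deriv (W N) = (\<lambda>_. 0)"
  by (auto simp: bdry_zero_def)

lemma observable_force:
  assumes "j \<in> {1..N}"
  shows "observable (\<lambda>x. force N e U V x j)"
  unfolding force_eq using assms
  by (cases "j = 1")
    (auto intro!: observable_add observable_diff observable_uminus observable_mom observable_pos
      observable_const observable_comp[OF smooth_deriv[OF smooth_W] observable_bond]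
      observable_comp[OF smooth_deriv[OF smooth_U]])

lemma observable_field: "observable (\<lambda>x. F x \<bullet> b)"
proof -
  \<comment> \<open>The position components of \<open>F x\<close> are the momenta, hence the linear
    term \<open>x \<bullet> (snd b, 0)\<close>.\<close>
  have "F x \<bullet> b = (\<Sum>j=1..N. force N e U V x j * (axis (e j) 1 \<bullet> fst b)) + x \<bullet> (snd b, 0)" for x
    by (cases x; cases b) (simp add: chain_field_def inner_sum_left)
  then show ?thesis
    by (auto intro!: observable_add observable_sum observable_mult observable_force
        observable_const observable_coord)
qed

lemma lie_mom:
  assumes "j \<in> {1..N}"
  shows "lie F (mom e j) = (\<lambda>x. force N e U V x j)"
proof -
  have "lie F (mom e j) = (\<lambda>x. fst (F x) $ e j)"
    unfolding mom_eq_inner by (rule lie_coord)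
  also have "\<dots> = (\<lambda>x. force N e U V x j)"
    using chain_field_component[OF bij assms] by auto
  finally show ?thesis .
qed

lemma lie_pos: "lie F (pos e j) = mom e j"
proof -
  have "lie F (pos e j) = (\<lambda>x. snd (F x) $ e j)"
    unfolding pos_eq_inner by (rule lie_coord)
  then show ?thesis by (auto simp: chain_field_def)
qed

lemma lie_bond: "lie F (\<lambda>x. pos e i x - pos e j x) = (\<lambda>x. mom e i x - mom e j x)"
  by (simp add: lie_diff observable_pos lie_pos)

text \<open>Energy balance: the pinning forces cancel the change of pinning energy, the bond forces
  cancel by \<open>sum_bond_power\<close>, and the friction on the first oscillator remains.\<close>

lemma lie_hamiltonian: "lie F (hamiltonian N e U V) = (\<lambda>x. - (mom e 1 x * mom e 1 x))"
proof
  fix x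
  have H: "hamiltonian N e U V = (\<lambda>x. (\<Sum>j=1..N. (1/2) * (mom e j x * mom e j x))
      + (\<Sum>j=1..N. U j (pos e j x)) + (\<Sum>j=1..N-1. W j (pos e j x - pos e (j + 1) x)))"
  proof
    fix y :: "'n phase"
    show "hamiltonian N e U V y = (\<Sum>j=1..N. (1/2) * (mom e j y * mom e j y))
      + (\<Sum>j=1..N. U j (pos e j y)) + (\<Sum>j=1..N-1. W j (pos e j y - pos e (j + 1) y))"
      by (cases y) (auto simp: hamiltonian_def bdry_zero_def power2_eq_square intro!: sum.cong)
  qed
  have mom2: "lie F (\<lambda>x. (1/2) * (mom e j x * mom e j x)) = (\<lambda>x. mom e j x * force N e U V x j)"
    if "j \<in> {1..N}" for j
    using that unfolding lie_mult[OF observable_const observable_mult[OF observable_mom observable_mom]]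
    by (simp add: lie_const lie_mult observable_mom lie_mom)
  have obs: "observable (\<lambda>x. (1/2) * (mom e j x * mom e j x))"
    "observable (\<lambda>x. W j (pos e j x - pos e (j + 1) x))" for j
    by (intro observable_mult observable_const observable_mom
        observable_comp[OF smooth_W observable_bond])+
  have obsU: "observable (\<lambda>x. U j (pos e j x))" if "j \<in> {1..N}" for j
    using that by (auto intro!: observable_comp[OF smooth_U] observable_pos)
  let ?a = "\<lambda>j. deriv (W j) (pos e j x - pos e (j + 1) x)"
  have "lie F (hamiltonian N e U V) x = (\<Sum>j=1..N. mom e j x * force N e U V x j)
      + (\<Sum>j=1..N. deriv (U j) (pos e j x) * mom e j x)
      + (\<Sum>j=1..N-1. ?a j * (mom e j x - mom e (j + 1) x))"
  proof -
    have "lie F (hamiltonian N e U V) x =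
        (\<Sum>j=1..N. lie F (\<lambda>x. (1/2) * (mom e j x * mom e j x)) x)
        + (\<Sum>j=1..N. lie F (\<lambda>x. U j (pos e j x)) x)
        + (\<Sum>j=1..N-1. lie F (\<lambda>x. W j (pos e j x - pos e (j + 1) x)) x)"
      unfolding H
      by (simp only: lie_add lie_sum observable_add observable_sum obs obsU)
    moreover have "lie F (\<lambda>x. U j (pos e j x)) x = deriv (U j) (pos e j x) * mom e j x"
      if "j \<in> {1..N}" for j
      using lie_comp[OF smooth_U[OF that] observable_pos, where F = F] by (simp add: lie_pos)
    moreover have "lie F (\<lambda>x. W j (pos e j x - pos e (j + 1) x)) x =
        ?a j * (mom e j x - mom e (j + 1) x)" for j
      using lie_comp[OF smooth_W observable_bond, where F = F] by (simp add: lie_bond)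
    moreover have "(\<Sum>j=1..N. lie F (\<lambda>x. (1/2) * (mom e j x * mom e j x)) x)
        = (\<Sum>j=1..N. mom e j x * force N e U V x j)"
      by (intro sum.cong refl) (simp only: mom2)
    ultimately show ?thesis
      by simp
  qed
  also have "(\<Sum>j=1..N. mom e j x * force N e U V x j)
      + (\<Sum>j=1..N. deriv (U j) (pos e j x) * mom e j x)
      = (\<Sum>j=1..N. (if j = 1 then - (mom e 1 x * mom e 1 x) else 0))
        + (\<Sum>j=1..N. mom e j x * (?a (j - 1) - ?a j))"
    unfolding sum.distrib[symmetric]
    by (intro sum.cong) (auto simp: force_eq algebra_simps)
  \<comment> \<open>The end terms \<open>?a 0\<close> and \<open>?a N\<close> are zero, as
    \<open>W 0\<close> and \<open>W N\<close> have derivative zero.\<close>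
  finally show "lie F (hamiltonian N e U V) x = - (mom e 1 x * mom e 1 x)"
    using sum_bond_power[OF N, of "\<lambda>j. mom e j x" ?a] N by (simp add: del: One_nat_def)
qed

text \<open>The coupling to the next oscillator may be degenerate, which costs half of the order.\<close>

lemma flow_series_mom_Suc:
  assumes k: "1 \<le> k" "k < N"
    and nondeg: "(deriv ^^ 2) (V k) (pos e k x - pos e (k + 1) x) \<noteq> 0
      \<or> (deriv ^^ 3) (V k) (pos e k x - pos e (k + 1) x) \<noteq> 0"
    and dvd: "\<And>j. j \<in> {1..k} \<Longrightarrow> fps_X ^ (2 * m + 2) dvd flow_series F x (mom e j)"
  shows "fps_X ^ m dvd flow_series F x (mom e (k + 1))"
proof -
  let ?T = "flow_series F x"
  let ?w = "\<lambda>j x. deriv (W j) (pos e j x - pos e (j + 1) x)"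
  have obs_w: "observable (?w j)" for j
    by (rule observable_comp[OF smooth_deriv[OF smooth_W] observable_bond])
  have obs_u: "observable (\<lambda>x. deriv (U k) (pos e k x))"
    using k by (intro observable_comp[OF smooth_deriv[OF smooth_U]] observable_pos) auto
  have obs_f: "observable (\<lambda>x. force N e U V x k)"
    using k by (intro observable_force) auto
  have dvd': "fps_X ^ (2 * m) dvd ?T (mom e j)" if "j \<in> {1..k}" for j
    using dvd[OF that] by (rule power_le_dvd) simp
  \<comment> \<open>One derivative of the momentum occurs in the equation of motion, a second when
    that equation is differentiated; the surplus 2 in the order pays for both.\<close>
  have mom: "fps_X ^ (2 * m) dvd fps_deriv (?T (mom e j))"
      "fps_X ^ (2 * m) dvd fps_deriv (fps_deriv (?T (mom e j)))" if "j \<in> {1..k}" for j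
  proof -
    show *: "fps_X ^ (2 * m) dvd fps_deriv (fps_deriv (?T (mom e j)))"
      using dvd[OF that] by (intro fps_X_power_dvd_deriv) simp
    have "fps_X ^ Suc (2 * m) dvd fps_deriv (?T (mom e j))"
      using dvd[OF that] by (intro fps_X_power_dvd_deriv) simp
    then show "fps_X ^ (2 * m) dvd fps_deriv (?T (mom e j))"
      by (rule power_le_dvd) simp
  qed
  have "fps_X ^ (2 * m) dvd fps_deriv (?T (\<lambda>x. if k = 1 then mom e 1 x else 0))"
    using mom(1)[of 1] k by (cases "k = 1") (auto simp: flow_series_const)
  \<comment> \<open>By the chain rule this derivative is a multiple of the series of
    \<open>mom e k\<close>; that of the previous bond is a multiple of a momentum
    difference.\<close>
  moreover have "fps_X ^ (2 * m) dvd fps_deriv (?T (\<lambda>x. deriv (U k) (pos e k x)))"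
  proof -
    have "smooth (deriv (U k))"
      using k by (intro smooth_deriv smooth_U) auto
    then show ?thesis
      using fps_deriv_flow_series_comp[OF observable_field _ observable_pos] dvd'[of k] k
      by (simp add: lie_pos)
  qed
  moreover have "fps_X ^ (2 * m) dvd fps_deriv (?T (?w (k - 1)))"
  proof (cases "k = 1")
    case False
    then have "fps_X ^ (2 * m) dvd ?T (mom e (k - 1)) - ?T (mom e k)"
      using k by (intro dvd_diff dvd') auto
    then show ?thesis
      using fps_deriv_flow_series_comp[OF observable_field smooth_deriv[OF smooth_W] observable_bond] k
      by (simp add: lie_bond flow_series_diff[OF observable_field] observable_mom)
  qed (simp add: flow_series_const)
  moreover have "fps_X ^ (2 * m) dvd fps_deriv (?T (\<lambda>x. force N e U V x k))"
    using mom(2)[of k] k by (simp add: fps_deriv_flow_series lie_mom)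
  \<comment> \<open>The equation of motion of oscillator \<open>k\<close>, solved for the force of
    the bond to its successor.\<close>
  moreover have "?w k = (\<lambda>x. - (if k = 1 then mom e 1 x else 0) - deriv (U k) (pos e k x)
      + ?w (k - 1) x - force N e U V x k)"
    using k by (auto simp: force_eq)
  then have "?T (?w k) = - ?T (\<lambda>x. if k = 1 then mom e 1 x else 0)
      - ?T (\<lambda>x. deriv (U k) (pos e k x)) + ?T (?w (k - 1)) - ?T (\<lambda>x. force N e U V x k)"
    using obs_u obs_f
    by (cases "k = 1") (simp_all add: flow_series_add[OF observable_field]
        flow_series_diff[OF observable_field] flow_series_uminus[OF observable_field]
        observable_add observable_diff observable_uminus observable_mom
        observable_const obs_w flow_series_const del: One_nat_def)
  ultimately have "fps_X ^ (2 * m) dvd fps_deriv (?T (?w k))"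
    by (simp add: dvd_diff dvd_add del: One_nat_def)
  moreover have "deriv (deriv (W k)) (pos e k x - pos e (k + 1) x) \<noteq> 0
      \<or> deriv (deriv (deriv (W k))) (pos e k x - pos e (k + 1) x) \<noteq> 0"
    using nondeg k by (simp add: bdry_zero_def numeral_2_eq_2 numeral_3_eq_3)
  ultimately have "fps_X ^ m dvd ?T (lie F (\<lambda>x. pos e k x - pos e (k + 1) x))"
    using fps_X_power_dvd_flow_series_comp[OF observable_field smooth_deriv[OF smooth_W] observable_bond]
    by blast
  then have diff: "fps_X ^ m dvd ?T (mom e k) - ?T (mom e (k + 1))"
    by (simp add: lie_bond flow_series_diff[OF observable_field] observable_mom)
  have "fps_X ^ m dvd ?T (mom e k)"
    by (rule power_le_dvd[OF dvd']) (use k in auto)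
  from dvd_diff[OF this diff] show ?thesis
    by simp
qed

text \<open>The orders \<open>a k = 3 * 2 ^ (N + 1 - k) - 2\<close> solve the recursion
  \<open>a k = 2 * a (k + 1) + 2\<close> of \<open>flow_series_mom_Suc\<close> with
  \<open>a N = 4\<close>. Extracting the root of \<open>p\<^sub>1\<^sup>2\<close> requires order
  \<open>2 * a 1 - 1\<close>, which is \<open>3 * 2 ^ (N + 1) - 5\<close>.\<close>

lemma equilibrium_if_lie_hamiltonian_eq_0:
  assumes nondeg: "\<And>k y. k \<in> {1..N-1} \<Longrightarrow> (deriv ^^ 2) (V k) y \<noteq> 0 \<or> (deriv ^^ 3) (V k) y \<noteq> 0"
    and eq_0: "\<And>j. 1 \<le> j \<Longrightarrow> j \<le> 3 * 2 ^ (N + 1) - 5 \<Longrightarrow> (lie F ^^ j) (hamiltonian N e U V) x = 0"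
    and j: "j \<in> {1..N}"
  shows "mom e j x = 0" "force N e U V x j = 0"
proof -
  let ?T = "flow_series F x"
  \<comment> \<open>Coefficient \<open>i\<close> of this series belongs to the iterate
    \<open>Suc i\<close> on the Hamiltonian, so the iterates start at 1.\<close>
  have "fps_X ^ (3 * 2 ^ (N + 1) - 5) dvd ?T (lie F (hamiltonian N e U V))"
    using eq_0[of "Suc _"]
    by (simp add: fps_X_power_dvd_iff_nth flow_series_nth funpow_Suc_right del: funpow.simps)
  moreover have "3 * 2 ^ (N + 1) - 5 = 2 * (3 * 2 ^ N - 2) - (1::nat)"
    by simp
  ultimately have "fps_X ^ (2 * (3 * 2 ^ N - 2) - 1) dvd ?T (mom e 1) * ?T (mom e 1)"
    by (simp add: lie_hamiltonian flow_series_uminus[OF observable_field] observable_mult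
        flow_series_mult[OF observable_field] observable_mom del: One_nat_def)
  then have first: "fps_X ^ (3 * 2 ^ N - 2) dvd ?T (mom e 1)"
    by (rule fps_X_power_dvd_square)
  \<comment> \<open>All \<open>j \<le> k\<close> are carried along because the equation of motion of
    oscillator \<open>k\<close> also involves its left neighbour.\<close>
  have "\<forall>j\<in>{1..k}. fps_X ^ (3 * 2 ^ (N + 1 - k) - 2) dvd ?T (mom e j)" if "1 \<le> k" "k \<le> N" for k
    using that
  proof (induction k rule: nat_induct_at_least)
    case base
    then show ?case using first by simp
  next
    case (Suc k)
    define m :: nat where "m = 3 * 2 ^ (N - k) - 2"
    have "(2::nat) ^ (N + 1 - k) = 2 * 2 ^ (N - k)" "(1::nat) \<le> 2 ^ (N - k)"
      using Suc.prems by (simp_all add: Suc_diff_le)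
    then have exp: "3 * 2 ^ (N + 1 - k) - 2 = 2 * m + 2"
      unfolding m_def by linarith
    have IH: "fps_X ^ (2 * m + 2) dvd ?T (mom e j)" if "j \<in> {1..k}" for j
      using Suc that exp by simp
    have "fps_X ^ m dvd ?T (mom e (k + 1))"
      using Suc.prems Suc.hyps nondeg by (intro flow_series_mom_Suc IH) auto
    moreover have "fps_X ^ m dvd ?T (mom e j)" if "j \<in> {1..k}" for j
      using IH[OF that] by (rule power_le_dvd) simp
    ultimately show ?case
      by (auto simp: m_def le_Suc_eq)
  qed
  from this[of N] N j have "fps_X ^ 4 dvd ?T (mom e j)"
    by simp
  then have "fps_nth (?T (mom e j)) i = 0" if "i < 4" for i
    using that by (simp add: fps_X_power_dvd_iff_nth)
  \<comment> \<open>Coefficients 0 and 1 are the momentum and its Lie derivative, the force.\<close>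
  from this[of 0] this[of 1] show "mom e j x = 0" "force N e U V x j = 0"
    using j by (simp_all add: flow_series_nth lie_mom)
qed

end

subsection \<open>Boundedness of the equilibria\<close>

text \<open>\<open>deriv v\<close> is bounded on a compact interval around 0 by continuity and
  nondecreasing on either side of it, so moving outwards it can only grow to the right and only fall
  to the left.\<close>

lemma deriv_one_sided_bounds:
  assumes "smooth v" and pos: "\<And>x. \<bar>x\<bar> \<ge> R \<Longrightarrow> (deriv ^^ 2) v x > 0"
  shows "\<exists>C\<ge>0. (\<forall>x\<ge>0. deriv v x \<ge> - C) \<and> (\<forall>x\<le>0. deriv v x \<le> C)"
proof -
  let ?R = "\<bar>R\<bar>"
  have D: "(deriv v has_real_derivative (deriv ^^ 2) v x) (at x)" for x
    using smooth_DERIV[OF smooth_deriv[OF assms(1)]] by (simp add: numeral_2_eq_2)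
  have "compact (deriv v ` {-?R..?R})"
    by (intro compact_continuous_image continuous_at_imp_continuous_on ballI DERIV_isCont[OF D]
        compact_Icc)
  then have "bounded (deriv v ` {-?R..?R})"
    by (rule compact_imp_bounded)
  then obtain C where "\<forall>y\<in>deriv v ` {-?R..?R}. norm y \<le> C"
    unfolding bounded_iff ..
  then have C: "\<bar>deriv v x\<bar> \<le> C" if "x \<in> {-?R..?R}" for x
    using that by auto
  have "C \<ge> 0" using C[of 0] by auto
  moreover have "deriv v x \<ge> - C" if "x \<ge> 0" for x
  proof (cases "x \<le> ?R")
    case False
    have "deriv v ?R \<le> deriv v x"
    proof (rule DERIV_nonneg_imp_nondecreasing[where f = "deriv v"])
      fix t assume "?R \<le> t"
      then have "R \<le> \<bar>t\<bar>" by linarith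
      then have "0 \<le> (deriv ^^ 2) v t" by (rule less_imp_le[OF pos])
      with D show "\<exists>y. (deriv v has_real_derivative y) (at t) \<and> 0 \<le> y" by blast
    qed (use False in simp)
    then show ?thesis using C[of ?R] by auto
  qed (use C[of x] that in auto)
  moreover have "deriv v x \<le> C" if "x \<le> 0" for x
  proof (cases "- ?R \<le> x")
    case False
    have "deriv v x \<le> deriv v (- ?R)"
    proof (rule DERIV_nonneg_imp_nondecreasing[where f = "deriv v"])
      fix t assume "t \<le> - ?R"
      then have "R \<le> \<bar>t\<bar>" by linarith
      then have "0 \<le> (deriv ^^ 2) v t" by (rule less_imp_le[OF pos])
      with D show "\<exists>y. (deriv v has_real_derivative y) (at t) \<and> 0 \<le> y" by blast
    qed (use False in simp)
    then show ?thesis using C[of "- ?R"] by auto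
  qed (use C[of x] that in auto)
  ultimately show ?thesis by blast
qed

lemma filterlim_beyond_bound:
  fixes u :: "real \<Rightarrow> real"
  assumes "filterlim u at_top at_top" "filterlim u at_bot at_bot"
  obtains b where "b \<ge> 0" "\<And>y. y \<ge> b \<Longrightarrow> u y > c" "\<And>y. y \<le> - b \<Longrightarrow> u y < - c"
proof -
  obtain b1 where "\<And>y. y \<ge> b1 \<Longrightarrow> u y > c"
    using assms(1) unfolding filterlim_at_top_dense eventually_at_top_linorder by blast
  moreover obtain b2 where "\<And>y. y \<le> b2 \<Longrightarrow> u y < - c"
    using assms(2) unfolding filterlim_at_bot_dense eventually_at_bot_linorder by blast
  ultimately show thesis
    by (intro that[of "max 0 (max b1 (- b2))"]) auto
qed

context oscillator_chain
begin

text \<open>At an equilibrium the couplings push the oscillator with the largest coordinate upwards with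
  bounded force only, and this has to balance its pinning force; likewise for the smallest one.\<close>

lemma equilibria_bounded:
  assumes V'': "\<And>k x. k \<in> {1..N-1} \<Longrightarrow> \<bar>x\<bar> \<ge> R \<Longrightarrow> (deriv ^^ 2) (V k) x > 0"
    and U': "\<And>k. k \<in> {1..N} \<Longrightarrow> filterlim (deriv (U k)) at_top at_top"
      "\<And>k. k \<in> {1..N} \<Longrightarrow> filterlim (deriv (U k)) at_bot at_bot"
  obtains B where "\<And>x j. (\<And>i. i \<in> {1..N} \<Longrightarrow> mom e i x = 0 \<and> force N e U V x i = 0) \<Longrightarrow>
    j \<in> {1..N} \<Longrightarrow> \<bar>pos e j x\<bar> \<le> B"
proof -
  \<comment> \<open>Outside \<open>{1..<N}\<close> the coupling is zero, so \<open>c\<close> can be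
    chosen for all indices.\<close>
  have "\<exists>C\<ge>0. (\<forall>x\<ge>0. deriv (W k) x \<ge> - C) \<and> (\<forall>x\<le>0. deriv (W k) x \<le> C)" for k
  proof (cases "1 \<le> k \<and> k < N")
    case True
    then have k: "k \<in> {1..N-1}" by auto
    from True have "W k = V k" by (auto simp: bdry_zero_def)
    then show ?thesis
      by (simp only:) (rule deriv_one_sided_bounds[OF smooth_V[OF k] V''[OF k]])
  qed (auto simp: bdry_zero_def)
  then obtain c where c: "\<And>k. c k \<ge> 0" "\<And>k x. x \<ge> 0 \<Longrightarrow> deriv (W k) x \<ge> - c k"
      "\<And>k x. x \<le> 0 \<Longrightarrow> deriv (W k) x \<le> c k"
    by metis
  \<comment> \<open>Beyond \<open>b k\<close> the pinning force exceeds what the two adjacent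
    couplings can oppose at an extremal oscillator.\<close>
  have "\<exists>b\<ge>0. (\<forall>y\<ge>b. deriv (U k) y > c (k - 1) + c k) \<and> (\<forall>y\<le>-b. deriv (U k) y < - (c (k - 1) + c k))"
    if "k \<in> {1..N}" for k
    using filterlim_beyond_bound[OF U'[OF that]] by metis
  then obtain b where b: "\<And>k. k \<in> {1..N} \<Longrightarrow> b k \<ge> 0"
      "\<And>k y. k \<in> {1..N} \<Longrightarrow> y \<ge> b k \<Longrightarrow> deriv (U k) y > c (k - 1) + c k"
      "\<And>k y. k \<in> {1..N} \<Longrightarrow> y \<le> - b k \<Longrightarrow> deriv (U k) y < - (c (k - 1) + c k)"
    by metis
  have b_le: "b k \<le> sum b {1..N}" if "k \<in> {1..N}" for k
    using that b(1) by (intro member_le_sum) auto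
  show thesis
  proof (rule that[of "sum b {1..N}"])
    fix x j
    assume equil: "\<And>i. i \<in> {1..N} \<Longrightarrow> mom e i x = 0 \<and> force N e U V x i = 0" and j: "j \<in> {1..N}"
    let ?q = "\<lambda>i. pos e i x"
    \<comment> \<open>The friction term drops out because \<open>mom e 1 x = 0\<close>.\<close>
    have U_eq: "deriv (U k) (?q k) =
        deriv (W (k - 1)) (?q (k - 1) - ?q k) - deriv (W k) (?q k - ?q (k + 1))" if "k \<in> {1..N}" for k
      using equil[OF that] equil[of 1] N by (auto simp: force_eq split: if_splits)
    have fin: "finite (?q ` {1..N})" "?q ` {1..N} \<noteq> {}"
      using N by auto
    from Max_in[OF fin] obtain k where k: "Max (?q ` {1..N}) = ?q k" "k \<in> {1..N}"
      by (rule imageE)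
    have le_k: "?q i \<le> ?q k" if "i \<in> {1..N}" for i
      using fin that by (simp add: k(1)[symmetric])
    \<comment> \<open>At a maximum the left bond has argument \<le> 0 and the right bond \<ge> 0,
      the sides on which \<open>c\<close> gives the bounds needed; at an end of the chain the
      missing bond exerts no force.\<close>
    have "deriv (W (k - 1)) (?q (k - 1) - ?q k) \<le> c (k - 1)"
    proof (cases "k = 1")
      case False
      with k(2) have "k - 1 \<in> {1..N}" by auto
      from le_k[OF this] show ?thesis by (intro c(3)) simp
    qed (simp add: c(1))
    moreover have "- c k \<le> deriv (W k) (?q k - ?q (k + 1))"
    proof (cases "k = N")
      case False
      with k(2) have "k + 1 \<in> {1..N}" by auto
      from le_k[OF this] show ?thesis by (intro c(2)) simp
    qed (simp add: c(1))
    ultimately have "deriv (U k) (?q k) \<le> c (k - 1) + c k"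
      using U_eq[OF k(2)] by linarith
    then have "?q k < b k"
      using b(2)[OF k(2), of "?q k"] by linarith
    then have upper: "?q j \<le> sum b {1..N}"
      using le_k[OF j] b_le[OF k(2)] by linarith
    from Min_in[OF fin] obtain l where l: "Min (?q ` {1..N}) = ?q l" "l \<in> {1..N}"
      by (rule imageE)
    have le_l: "?q l \<le> ?q i" if "i \<in> {1..N}" for i
      using fin that by (simp add: l(1)[symmetric])
    have "- c (l - 1) \<le> deriv (W (l - 1)) (?q (l - 1) - ?q l)"
    proof (cases "l = 1")
      case False
      with l(2) have "l - 1 \<in> {1..N}" by auto
      from le_l[OF this] show ?thesis by (intro c(2)) simp
    qed (simp add: c(1))
    moreover have "deriv (W l) (?q l - ?q (l + 1)) \<le> c l"
    proof (cases "l = N")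
      case False
      with l(2) have "l + 1 \<in> {1..N}" by auto
      from le_l[OF this] show ?thesis by (intro c(3)) simp
    qed (simp add: c(1))
    ultimately have "- (c (l - 1) + c l) \<le> deriv (U l) (?q l)"
      using U_eq[OF l(2)] by linarith
    then have "- b l < ?q l"
      using b(3)[OF l(2), of "?q l"] by linarith
    then have "?q j \<ge> - sum b {1..N}"
      using le_l[OF j] b_le[OF l(2)] by linarith
    with upper show "\<bar>?q j\<bar> \<le> sum b {1..N}" by linarith
  qed
qed

lemma bounded_phase_box:
  "bounded {x :: 'n phase. \<forall>j\<in>{1..N}. mom e j x = 0 \<and> \<bar>pos e j x\<bar> \<le> B}"
proof -
  have "{x :: 'n phase. \<forall>j\<in>{1..N}. mom e j x = 0 \<and> \<bar>pos e j x\<bar> \<le> B}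
      \<subseteq> {0} \<times> cbox (\<chi> i. - B) (\<chi> i. B)"
  proof
    fix x :: "'n phase"
    assume x: "x \<in> {x. \<forall>j\<in>{1..N}. mom e j x = 0 \<and> \<bar>pos e j x\<bar> \<le> B}"
    \<comment> \<open>Every index is some \<open>e j\<close>, so bounds on the numbered coordinates
      control the whole vector.\<close>
    have "fst x $ i = 0 \<and> \<bar>snd x $ i\<bar> \<le> B" for i
    proof -
      obtain j where "j \<in> {1..N}" "i = e j"
        using bij by (metis UNIV_I bij_betw_imp_surj_on imageE)
      with x show ?thesis by auto
    qed
    then show "x \<in> {0} \<times> cbox (\<chi> i. - B) (\<chi> i. B)"
      by (cases x) (auto simp: vec_eq_iff mem_box_cart abs_le_iff minus_le_iff)
  qed
  then show ?thesis
    by (rule bounded_subset[rotated]) (intro bounded_Times bounded_cbox finite_imp_bounded finite.intros)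
qed

end

theorem theorem4p3:
  fixes N :: nat and e :: "nat \<Rightarrow> 'n::finite" and U V :: "nat \<Rightarrow> real \<Rightarrow> real"
  assumes "N \<ge> 2"
    and "bij_betw e {1..N} (UNIV :: 'n set)"
    and "\<forall>k\<in>{1..N}. smooth (U k)"
    and "\<forall>k\<in>{1..N-1}. smooth (V k)"
    and "\<exists>R\<ge>0. \<forall>k\<in>{1..N-1}. \<forall>x. \<bar>x\<bar> \<ge> R \<longrightarrow> (deriv ^^ 2) (V k) x > 0"
    and "\<forall>k\<in>{1..N}. filterlim (deriv (U k)) at_top at_top"
    and "\<forall>k\<in>{1..N}. filterlim (deriv (U k)) at_bot at_bot"
    and "\<forall>k\<in>{1..N-1}. \<forall>x. (deriv ^^ 2) (V k) x \<noteq> 0 \<or> (deriv ^^ 3) (V k) x \<noteq> 0"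
  shows "\<exists>K :: ('n phase) set. bounded K \<and>
    (\<forall>p q. (p, q) \<notin> K \<longrightarrow>
      (\<exists>j. 1 \<le> j \<and> j \<le> 3 * 2 ^ (N + 1) - 5 \<and>
        (lie (chain_field N e U V) ^^ j) (hamiltonian N e U V) (p, q) \<noteq> 0))"
proof -
  interpret oscillator_chain N e U V
    using assms by unfold_locales auto
  obtain R where "\<And>k x. k \<in> {1..N-1} \<Longrightarrow> \<bar>x\<bar> \<ge> R \<Longrightarrow> (deriv ^^ 2) (V k) x > 0"
    using assms(5) by blast
  then obtain B where B: "\<And>x j. (\<And>i. i \<in> {1..N} \<Longrightarrow> mom e i x = 0 \<and> force N e U V x i = 0) \<Longrightarrow>
      j \<in> {1..N} \<Longrightarrow> \<bar>pos e j x\<bar> \<le> B"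
    by (rule equilibria_bounded) (use assms(6,7) in auto)
  \<comment> \<open>This box contains every equilibrium, as \<open>B\<close> is uniform in the
    point.\<close>
  let ?K = "{x :: 'n phase. \<forall>j\<in>{1..N}. mom e j x = 0 \<and> \<bar>pos e j x\<bar> \<le> B}"
  have "\<exists>j. 1 \<le> j \<and> j \<le> 3 * 2 ^ (N + 1) - 5 \<and> (lie F ^^ j) (hamiltonian N e U V) x \<noteq> 0"
    if "x \<notin> ?K" for x
  proof (rule ccontr)
    assume "\<not> ?thesis"
    then have "mom e i x = 0 \<and> force N e U V x i = 0" if "i \<in> {1..N}" for i
      using equilibrium_if_lie_hamiltonian_eq_0[of x i] assms(8) that by blast
    with B[of x] \<open>x \<notin> ?K\<close> show False by blast
  qed
  then show ?thesis
    using bounded_phase_box by blast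
qed

end
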